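(* Let $J(\boldsymbol k)=\det(\nabla\boldsymbol v)(\boldsymbol k)$ be the Jacobian of the velocity map $\boldsymbol v$, and let $\operatorname{Sing}(J)=\{\boldsymbol k\in\mathbb T^2: J(\boldsymbol k)=0\}$ be its singular set. (1) Let $(a,b)\in\Delta_{(0,1)}$ ($a,b>0$, $a+b<1$). Then $|J|_{\pm1}^{-1}=\pi^2f_\pm$; that is, with $\boldsymbol v=\boldsymbol v(\boldsymbol k)$, $|J(\boldsymbol k)|^{-1}=\pi^2f_+(\boldsymbol v)$ where $J(\boldsymbol k)<0$, and $|J(\boldsymbol k)|^{-1}=\pi^2f_-(\boldsymbol v)$ where $J(\boldsymbol k)>0$. The limit PDF forms a caustic, diverging on the image of the singular set, which coincides with the boundary of the support: $\boldsymbol v(\operatorname{Sing}(J))=\partial\Sigma(\hat{\boldsymbol v})$. (2) Let $(a,b)\in\Delta_1$ ($a,b>0$, $a+b=1$). Then $|J|^{-1}=\pi^2f$, i.e. $|J(\boldsymbol k)|^{-1}=\pi^2f(\boldsymbol v(\boldsymbol k))$. The limit PDF diverges on the image of the singular set, which, in this case, is the discrete four-point set $\boldsymbol v(\operatorname{Sing}(J))=\{\pm(1,a-b),\ \pm(a-b,1)\}$.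
   Context: Walk and limit PDF. Parameters: $a_1,a_2\in[0,1]$, $b_j=\sqrt{1-a_j^2}$, $a=a_1a_2$, $b=b_1b_2$. On $\mathcal H=\ell^2(\mathbb Z^2;\mathbb C^2)$, with $\Psi=(\Psi^{(+)},\Psi^{(-)})^T$, let $(S_j\Psi)^{(\pm)}(\boldsymbol x)=\Psi^{(\pm)}(\boldsymbol x\pm\boldsymbol e_j)$ ($\boldsymbol e_j$ the standard basis), $C_j=\begin{pmatrix}a_j&b_j\\-b_j&a_j\end{pmatrix}$ (acting pointwise), $U=S_2C_2S_1C_1$, $\Psi_t=U^t\Psi_0$ with $\Psi_0$ normalized, and let $\boldsymbol X_t$ have law $P(\boldsymbol X_t=\boldsymbol x)=\|\Psi_t(\boldsymbol x)\|^2_{\mathbb C^2}$. The limit PDF is the probability density of the limiting distribution of $\boldsymbol X_t/t$ as $t\to\infty$; it has the form $w_+f_++w_-f_-$ when $(a,b)\in\Delta_{(0,1)}$ and $w_+f$ when $(a,b)\in\Delta_1$, with $f_\pm$, $f$ as below and weight functions $w_\pm$ determined by the initial state $\Psi_0$. Velocity map. $\mathbb T=\mathbb R/2\pi\mathbb Z$. For $\boldsymbol k=(k_1,k_2)\in\mathbb T^2$: $l_1=k_2+k_1$, $l_2=k_2-k_1$, $c_i=\cos l_i$, $s_i=\sin l_i$, $\tau=ac_1-bc_2$, and $\boldsymbol v=(v_1,v_2)$ with $v_1=-\frac{as_1+bs_2}{\sqrt{1-\tau^2}}$, $v_2=-\frac{as_1-bs_2}{\sqrt{1-\tau^2}}$.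 If $a+b<1$ then $\tau^2<1$ everywhere; if $a+b=1$ then $\boldsymbol v$ and $J$ are considered at points where $\tau^2\neq1$ (almost everywhere). $\nabla\boldsymbol v$ is the Jacobian matrix with respect to $(k_1,k_2)$. $\Sigma(\hat{\boldsymbol v})$ is the joint spectrum of the velocity operators (the support of their joint spectral measure), i.e. the closure of the union of the images of $\boldsymbol v$ and $-\boldsymbol v$; it is the support of the limit distribution. Functions. For $j=1,2$, $F_j(\boldsymbol v)=1-\frac{(v_1+v_2)^2}{4a_j^2}-\frac{(v_1-v_2)^2}{4b_j^2}$, $E_j=\{F_j\ge0\}$; $F_0(\boldsymbol v)=\frac{(a_1b_2)^2+(a_2b_1)^2}{2ab}\Bigl[1-\frac{(v_1+v_2)^2}{4a_0^2}-\frac{(v_1-v_2)^2}{4b_0^2}\Bigr]$, $a_0^2=\frac{(a_1b_2)^2+(a_2b_1)^2}{b_1^2+b_2^2}$, $b_0^2=\frac{(a_1b_2)^2+(a_2b_1)^2}{a_1^2+a_2^2}$; $f_\pm=\frac{F_0\pm\sqrt{F_1F_2}}{2\pi^2(1-v_1^2)(1-v_2^2)\sqrt{F_1F_2}}I_{E_1\cap E_2}$. Further $E=\{\boldsymbol v:\frac{(v_1+v_2)^2}{4a}+\frac{(v_1-v_2)^2}{4b}\le1\}$ and $f=\frac{1}{\pi^2(1-v_1^2)(1-v_2^2)}I_E$; $I_S$ is the indicator function of $S$. The notation $|J|_{+1}^{-1}$ (resp. $|J|_{-1}^{-1}$) means the reciprocal of $|J|$, as a function of the velocity, on the branches where $J<0$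 (resp. $J>0$).
   Formalization: Divergence of the limit PDF is stated for nonnegative weights and only along approaches where the total weight stays bounded away from 0, since an initial state may carry no weight near a caustic point; divergence of f_+, f_- and f themselves is unconditional. *)

theory Defs
  imports "HOL-Analysis.Analysis"
begin

definition coin_b :: "real \<Rightarrow> real" where
  "coin_b \<alpha> = sqrt (1 - \<alpha>\<^sup>2)"

definition par_a :: "real \<Rightarrow> real \<Rightarrow> real" where
  "par_a a1 a2 = a1 * a2"

definition par_b :: "real \<Rightarrow> real \<Rightarrow> real" where
  "par_b a1 a2 = coin_b a1 * coin_b a2"


text \<open>The walk. A state maps lattice points to \<open>complex ^ 2\<close>, whose norm is the Euclidean
  one; component 1 is the \<open>(+)\<close> component and component 2 the \<open>(-)\<close> component.\<close>

type_synonym state = "int ^ 2 \<Rightarrow> complex ^ 2"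

definition normalized :: "state \<Rightarrow> bool" where
  "normalized \<Psi> \<longleftrightarrow> ((\<lambda>x. (norm (\<Psi> x))\<^sup>2) has_sum 1) UNIV"

definition shift :: "2 \<Rightarrow> state \<Rightarrow> state" where
  "shift j \<Psi> = (\<lambda>x. vector [\<Psi> (x + axis j 1) $ 1, \<Psi> (x - axis j 1) $ 2])"

definition coin_matrix :: "real \<Rightarrow> complex ^ 2 ^ 2" where
  "coin_matrix \<alpha> = vector [vector [of_real \<alpha>, of_real (coin_b \<alpha>)],
                           vector [- of_real (coin_b \<alpha>), of_real \<alpha>]]"

definition coin :: "real \<Rightarrow> state \<Rightarrow> state" where
  "coin \<alpha> \<Psi> = (\<lambda>x. coin_matrix \<alpha> *v \<Psi> x)"

definition walk :: "real \<Rightarrow> real \<Rightarrow> state \<Rightarrow> state" where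
  "walk a1 a2 = shift 2 \<circ> coin a2 \<circ> shift 1 \<circ> coin a1"

definition evolve :: "real \<Rightarrow> real \<Rightarrow> state \<Rightarrow> nat \<Rightarrow> state" where
  "evolve a1 a2 \<Psi> t = (walk a1 a2 ^^ t) \<Psi>"

definition position_law :: "real \<Rightarrow> real \<Rightarrow> state \<Rightarrow> nat \<Rightarrow> (int ^ 2) measure" where
  "position_law a1 a2 \<Psi> t =
     density (count_space UNIV) (\<lambda>x. ennreal ((norm (evolve a1 a2 \<Psi> t x))\<^sup>2))"

definition velocity_law :: "real \<Rightarrow> real \<Rightarrow> state \<Rightarrow> nat \<Rightarrow> (real ^ 2) measure" where
  "velocity_law a1 a2 \<Psi> t =
     distr (position_law a1 a2 \<Psi> t) borel (\<lambda>x. \<chi> i. real_of_int (x $ i) / real t)"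

definition converges_in_law ::
  "(nat \<Rightarrow> 'a::topological_space measure) \<Rightarrow> 'a measure \<Rightarrow> bool" where
  "converges_in_law \<mu> \<nu> \<longleftrightarrow>
     (\<forall>h :: 'a \<Rightarrow> real. continuous_on UNIV h \<and> bounded (range h) \<longrightarrow>
        (\<lambda>t. integral\<^sup>L (\<mu> t) h) \<longlonglongrightarrow> integral\<^sup>L \<nu> h)"

definition limit_pdf :: "real \<Rightarrow> real \<Rightarrow> state \<Rightarrow> (real ^ 2 \<Rightarrow> real) \<Rightarrow> bool" where
  "limit_pdf a1 a2 \<Psi> p \<longleftrightarrow>
     p \<in> borel_measurable borel \<and> (\<forall>v. 0 \<le> p v) \<and>
     converges_in_law (velocity_law a1 a2 \<Psi>) (density lborel (\<lambda>v. ennreal (p v)))"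


text \<open>The velocity map. Functions on the torus are represented by \<open>2 * pi\<close>-periodic functions
  on \<open>real ^ 2\<close>, and subsets of the torus by their periodic lifts. The points with
  \<open>tau\<^sup>2 = 1\<close>, where the velocity is undefined, exist only if \<open>a + b = 1\<close>; they are excluded
  from \<open>regular\<close>.\<close>

definition tau :: "real \<Rightarrow> real \<Rightarrow> real ^ 2 \<Rightarrow> real" where
  "tau a b k = a * cos (k $ 2 + k $ 1) - b * cos (k $ 2 - k $ 1)"

definition regular :: "real \<Rightarrow> real \<Rightarrow> (real ^ 2) set" where
  "regular a b = {k. (tau a b k)\<^sup>2 \<noteq> 1}"

definition velocity :: "real \<Rightarrow> real \<Rightarrow> real ^ 2 \<Rightarrow> real ^ 2" where
  "velocity a b k = vector
     [- (a * sin (k $ 2 + k $ 1) + b * sin (k $ 2 - k $ 1)) / sqrt (1 - (tau a b k)\<^sup>2),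
      - (a * sin (k $ 2 + k $ 1) - b * sin (k $ 2 - k $ 1)) / sqrt (1 - (tau a b k)\<^sup>2)]"

definition J :: "real \<Rightarrow> real \<Rightarrow> real ^ 2 \<Rightarrow> real" where
  "J a b k = det (jacobian (velocity a b) (at k))"

definition Sing :: "real \<Rightarrow> real \<Rightarrow> (real ^ 2) set" where
  "Sing a b = {k \<in> regular a b. J a b k = 0}"

text \<open>The joint spectrum of the velocity operators.\<close>

definition Sigma_v :: "real \<Rightarrow> real \<Rightarrow> (real ^ 2) set" where
  "Sigma_v a b = closure (velocity a b ` regular a b \<union> (\<lambda>k. - velocity a b k) ` regular a b)"


text \<open>\<open>F \<alpha>\<close> is \<open>F\<^sub>j\<close> for \<open>\<alpha> = a\<^sub>j\<close>, and likewise \<open>E \<alpha>\<close> is \<open>E\<^sub>j\<close>.\<close>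

definition F :: "real \<Rightarrow> real ^ 2 \<Rightarrow> real" where
  "F \<alpha> v = 1 - (v $ 1 + v $ 2)\<^sup>2 / (4 * \<alpha>\<^sup>2) - (v $ 1 - v $ 2)\<^sup>2 / (4 * (coin_b \<alpha>)\<^sup>2)"

definition E :: "real \<Rightarrow> (real ^ 2) set" where
  "E \<alpha> = {v. 0 \<le> F \<alpha> v}"

definition cross_sq :: "real \<Rightarrow> real \<Rightarrow> real" where
  "cross_sq a1 a2 = (a1 * coin_b a2)\<^sup>2 + (a2 * coin_b a1)\<^sup>2"

definition a0_sq :: "real \<Rightarrow> real \<Rightarrow> real" where
  "a0_sq a1 a2 = cross_sq a1 a2 / ((coin_b a1)\<^sup>2 + (coin_b a2)\<^sup>2)"

definition b0_sq :: "real \<Rightarrow> real \<Rightarrow> real" where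
  "b0_sq a1 a2 = cross_sq a1 a2 / (a1\<^sup>2 + a2\<^sup>2)"

definition F0 :: "real \<Rightarrow> real \<Rightarrow> real ^ 2 \<Rightarrow> real" where
  "F0 a1 a2 v = cross_sq a1 a2 / (2 * par_a a1 a2 * par_b a1 a2) *
     (1 - (v $ 1 + v $ 2)\<^sup>2 / (4 * a0_sq a1 a2) - (v $ 1 - v $ 2)\<^sup>2 / (4 * b0_sq a1 a2))"

definition f_plus :: "real \<Rightarrow> real \<Rightarrow> real ^ 2 \<Rightarrow> real" where
  "f_plus a1 a2 v =
     (F0 a1 a2 v + sqrt (F a1 v * F a2 v)) /
     (2 * pi\<^sup>2 * (1 - (v $ 1)\<^sup>2) * (1 - (v $ 2)\<^sup>2) * sqrt (F a1 v * F a2 v))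
     * indicator (E a1 \<inter> E a2) v"

definition f_minus :: "real \<Rightarrow> real \<Rightarrow> real ^ 2 \<Rightarrow> real" where
  "f_minus a1 a2 v =
     (F0 a1 a2 v - sqrt (F a1 v * F a2 v)) /
     (2 * pi\<^sup>2 * (1 - (v $ 1)\<^sup>2) * (1 - (v $ 2)\<^sup>2) * sqrt (F a1 v * F a2 v))
     * indicator (E a1 \<inter> E a2) v"

definition E_crit :: "real \<Rightarrow> real \<Rightarrow> (real ^ 2) set" where
  "E_crit a b = {v. (v $ 1 + v $ 2)\<^sup>2 / (4 * a) + (v $ 1 - v $ 2)\<^sup>2 / (4 * b) \<le> 1}"

definition f_crit :: "real \<Rightarrow> real \<Rightarrow> real ^ 2 \<Rightarrow> real" where
  "f_crit a b v = 1 / (pi\<^sup>2 * (1 - (v $ 1)\<^sup>2) * (1 - (v $ 2)\<^sup>2)) * indicator (E_crit a b) v"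


text \<open>Divergence of a density \<open>p\<close> with total weight \<open>w\<close> on a set \<open>C\<close>, approached from inside
  the support \<open>\<Sigma>\<close>. Points of \<open>C\<close> themselves are left out, because the denominator of the
  density vanishes there and HOL division by zero returns 0. Since an initial state can
  carry no weight at all near a given velocity, where its density then vanishes, the approach
  is along any subset of \<open>\<Sigma> - C\<close> on which the weight is bounded away from 0; if the weight
  is bounded away from 0 near the point, this includes a full relative neighbourhood.\<close>

definition diverges_on ::
  "(real ^ 2) set \<Rightarrow> (real ^ 2) set \<Rightarrow> (real ^ 2 \<Rightarrow> real) \<Rightarrow> (real ^ 2 \<Rightarrow> real) \<Rightarrow> bool" where
  "diverges_on C \<Sigma> w p \<longleftrightarrow>
     (\<forall>v0 \<in> C. \<forall>S \<subseteq> \<Sigma> - C. (\<exists>c > 0. \<forall>v \<in> S. c \<le> w v) \<longrightarrow>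
        filterlim p at_top (at v0 within S))"

end

theory Submission
  imports Defs
begin

text \<open>
  With \<open>W = 1 - \<tau>\<^sup>2\<close>, \<open>M = 1 - a\<^sup>2 - b\<^sup>2\<close> and the quadratic form
  \<open>D = a b (c\<^sub>1\<^sup>2 + c\<^sub>2\<^sup>2) + M c\<^sub>1 c\<^sub>2\<close> in the cosines, everything is a rational function
  of \<open>D\<close> and \<open>W\<close> along the velocity map: \<open>J = - 4 a b D / W\<^sup>2\<close>, \<open>F\<^sub>1 F\<^sub>2 = (D / W)\<^sup>2\<close>,
  \<open>F\<^sub>0 = ((M\<^sup>2 - 4 a\<^sup>2 b\<^sup>2) / (2 a b) + D) / W\<close> and
  \<open>(1 - v\<^sub>1\<^sup>2) (1 - v\<^sub>2\<^sup>2) = (M\<^sup>2 - 4 a\<^sup>2 b\<^sup>2 + 4 a b D) / W\<^sup>2\<close>, which gives the densities.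

  For \<open>a + b < 1\<close> the image of \<open>v\<close> is compact and symmetric, hence equal to the joint spectrum.
  Points with \<open>J \<noteq> 0\<close> are mapped to its interior by the open mapping property. Points with \<open>D = 0\<close>
  have \<open>F\<^sub>1 = 0\<close> or \<open>F\<^sub>2 = 0\<close>, and scaling such a velocity by \<open>1 + \<delta>\<close> leaves
  \<open>E\<^sub>1 \<inter> E\<^sub>2\<close>, which contains the image, so they are mapped to the boundary.

  For \<open>a + b = 1\<close> one has \<open>M = 2 a b\<close>, so \<open>D = a b (c\<^sub>1 + c\<^sub>2)\<^sup>2\<close> and
  \<open>(1 - v\<^sub>1\<^sup>2) (1 - v\<^sub>2\<^sup>2) = \<bar>J\<bar>\<close>, which vanishes on the ellipse \<open>E\<close> only at its four points of
  contact with the square \<open>[-1, 1]\<^sup>2\<close>.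
\<close>

section \<open>The derivative and the Jacobian determinant of the velocity map\<close>

text \<open>The form \<open>D\<close> of the overview, whose zeros are the singular points.\<close>

definition jac_form :: "real \<Rightarrow> real \<Rightarrow> real ^ 2 \<Rightarrow> real" where
  "jac_form a b k = a * b * ((cos (k $ 2 + k $ 1))\<^sup>2 + (cos (k $ 2 - k $ 1))\<^sup>2)
     + (1 - a\<^sup>2 - b\<^sup>2) * (cos (k $ 2 + k $ 1) * cos (k $ 2 - k $ 1))"

text \<open>The coordinates of the velocity correspond to \<open>\<epsilon> = 1\<close> and \<open>\<epsilon> = - 1\<close>; their differentials are
  \<open>- velocity_num_deriv a b k \<epsilon> / W\<^bsup>3/2\<^esup>\<close>.\<close>

definition velocity_num_deriv :: "real \<Rightarrow> real \<Rightarrow> real ^ 2 \<Rightarrow> real \<Rightarrow> real ^ 2 \<Rightarrow> real" where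
  "velocity_num_deriv a b k \<epsilon> h =
     (a * cos (k $ 2 + k $ 1) * (h $ 2 + h $ 1) + \<epsilon> * b * cos (k $ 2 - k $ 1) * (h $ 2 - h $ 1))
       * (1 - (tau a b k)\<^sup>2)
     + (a * sin (k $ 2 + k $ 1) + \<epsilon> * b * sin (k $ 2 - k $ 1)) * tau a b k
       * (- a * sin (k $ 2 + k $ 1) * (h $ 2 + h $ 1) + b * sin (k $ 2 - k $ 1) * (h $ 2 - h $ 1))"

lemma velocity_coord_has_derivative:
  assumes "(tau a b k)\<^sup>2 < 1"
  shows "((\<lambda>k. - (a * sin (k $ 2 + k $ 1) + \<epsilon> * b * sin (k $ 2 - k $ 1)) / sqrt (1 - (tau a b k)\<^sup>2))
     has_derivative (\<lambda>h. - velocity_num_deriv a b k \<epsilon> h / sqrt (1 - (tau a b k)\<^sup>2) ^ 3)) (at k)"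
proof -
  have coord: "((\<lambda>k::real^2. k $ i) has_derivative (\<lambda>h. h $ i)) (at k)" for i
    by (rule bounded_linear.has_derivative[OF bounded_linear_vec_nth has_derivative_ident])
  have tau: "(tau a b has_derivative (\<lambda>h. - a * sin (k $ 2 + k $ 1) * (h $ 2 + h $ 1)
      + b * sin (k $ 2 - k $ 1) * (h $ 2 - h $ 1))) (at k)"
    unfolding tau_def[abs_def]
    by (rule derivative_eq_intros coord refl | simp add: algebra_simps)+
  define w where "w = sqrt (1 - (tau a b k)\<^sup>2)"
  have w: "w > 0" "w\<^sup>2 = 1 - (tau a b k)\<^sup>2"
    using assms by (simp_all add: w_def)
  have root: "((\<lambda>k. sqrt (1 - (tau a b k)\<^sup>2)) has_derivative
      (\<lambda>h. - tau a b k * (- a * sin (k $ 2 + k $ 1) * (h $ 2 + h $ 1)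
      + b * sin (k $ 2 - k $ 1) * (h $ 2 - h $ 1)) / w)) (at k)"
    using assms w
    by (auto intro!: derivative_eq_intros tau simp: w_def[symmetric] field_simps)
  have num: "((\<lambda>k. - (a * sin (k $ 2 + k $ 1) + \<epsilon> * b * sin (k $ 2 - k $ 1))) has_derivative
      (\<lambda>h. - (a * cos (k $ 2 + k $ 1) * (h $ 2 + h $ 1)
              + \<epsilon> * b * cos (k $ 2 - k $ 1) * (h $ 2 - h $ 1)))) (at k)"
    by (rule derivative_eq_intros coord refl | simp add: algebra_simps)+
  \<comment> \<open>The quotient rule leaves a fraction nested in the numerator; expanding by
    \<open>w\<close> gives the common denominator \<open>w ^ 3\<close> and turns
    \<open>w\<^sup>2\<close> into \<open>W\<close>.\<close>
  have simplify: "(- p * w - - s * (- t * d / w)) / (w * w) = - (p * w\<^sup>2 + s * t * d) / w ^ 3" for p s t d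
    using w(1) by (simp add: field_simps power2_eq_square power3_eq_cube)
  have "((\<lambda>k. - (a * sin (k $ 2 + k $ 1) + \<epsilon> * b * sin (k $ 2 - k $ 1)) / sqrt (1 - (tau a b k)\<^sup>2))
     has_derivative (\<lambda>h. - velocity_num_deriv a b k \<epsilon> h / w ^ 3)) (at k)"
    using has_derivative_divide'[OF num root] w(1)
    unfolding w_def[symmetric] simplify
    by (simp add: velocity_num_deriv_def w(2)[symmetric])
  then show ?thesis by (simp add: w_def)
qed

definition velocity_deriv where
  "velocity_deriv a b k h = (vector
      [- velocity_num_deriv a b k 1 h / sqrt (1 - (tau a b k)\<^sup>2) ^ 3,
       - velocity_num_deriv a b k (- 1) h / sqrt (1 - (tau a b k)\<^sup>2) ^ 3] :: real ^ 2)"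

lemma velocity_has_derivative:
  assumes "(tau a b k)\<^sup>2 < 1"
  shows "(velocity a b has_derivative velocity_deriv a b k) (at k)"
proof -
  have "((\<lambda>k. velocity a b k $ i) has_derivative (\<lambda>h. velocity_deriv a b k h $ i)) (at k)" for i
    using exhaust_2[of i] velocity_coord_has_derivative[OF assms, of 1]
      velocity_coord_has_derivative[OF assms, of "-1"]
    by (auto simp: velocity_def velocity_deriv_def)
  then show ?thesis
    by (subst has_derivative_componentwise_within) (auto simp: Basis_vec_def inner_axis)
qed

text \<open>In both rows the part without the factor \<open>W\<close> is a multiple of the
  differential of \<open>tau\<close>. These parts contribute no determinant of their own, so one
  factor \<open>W\<close> splits off. The change of coordinates from \<open>k\<close> to the angles
  \<open>k $ 2 + k $ 1\<close> and \<open>k $ 2 - k $ 1\<close> contributes a factor 2.\<close>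

lemma velocity_num_deriv_det:
  "velocity_num_deriv a b k 1 (axis 1 1) * velocity_num_deriv a b k (- 1) (axis 2 1)
    - velocity_num_deriv a b k 1 (axis 2 1) * velocity_num_deriv a b k (- 1) (axis 1 1)
   = - 4 * a * b * jac_form a b k * (1 - (tau a b k)\<^sup>2)"
proof -
  define c1 c2 s1 s2 where defs: "c1 = cos (k $ 2 + k $ 1)" "c2 = cos (k $ 2 - k $ 1)"
    "s1 = sin (k $ 2 + k $ 1)" "s2 = sin (k $ 2 - k $ 1)"
  define t where "t = tau a b k"
  have t: "t = a * c1 - b * c2"
    by (simp add: t_def tau_def defs)
  have s: "s1\<^sup>2 = 1 - c1\<^sup>2" "s2\<^sup>2 = 1 - c2\<^sup>2"
    by (simp_all add: defs sin_squared_eq)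
  \<comment> \<open>The cofactor of \<open>W\<close>: once the sines are eliminated, the terms with
    \<open>t\<^sup>2\<close> cancel because \<open>t = a * c1 - b * c2\<close>, which leaves a
    quadratic form.\<close>
  have "c1 * c2 * (1 - t\<^sup>2) + t * (b * c1 * s2\<^sup>2 - a * c2 * s1\<^sup>2) = jac_form a b k"
    unfolding s t jac_form_def defs(1,2)[symmetric]
    by (simp add: algebra_simps power2_eq_square)
  moreover have "velocity_num_deriv a b k 1 (axis 1 1) * velocity_num_deriv a b k (- 1) (axis 2 1)
    - velocity_num_deriv a b k 1 (axis 2 1) * velocity_num_deriv a b k (- 1) (axis 1 1)
    = - 4 * a * b * (c1 * c2 * (1 - t\<^sup>2) + t * (b * c1 * s2\<^sup>2 - a * c2 * s1\<^sup>2)) * (1 - t\<^sup>2)"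
    unfolding velocity_num_deriv_def defs[symmetric] t_def[symmetric]
    by (simp add: axis_def) algebra
  ultimately show ?thesis by (simp add: t_def)
qed

lemma J_eq:
  assumes "(tau a b k)\<^sup>2 < 1"
  shows "J a b k = - 4 * a * b * jac_form a b k / (1 - (tau a b k)\<^sup>2)\<^sup>2"
proof -
  define w where "w = sqrt (1 - (tau a b k)\<^sup>2)"
  have w: "w > 0" "1 - (tau a b k)\<^sup>2 = w\<^sup>2"
    using assms by (simp_all add: w_def)
  have "jacobian (velocity a b) (at k) = matrix (velocity_deriv a b k)"
    using frechet_derivative_at[OF velocity_has_derivative[OF assms]] by (simp add: jacobian_def)
  then have "J a b k = (velocity_num_deriv a b k 1 (axis 1 1) * velocity_num_deriv a b k (- 1) (axis 2 1)
    - velocity_num_deriv a b k 1 (axis 2 1) * velocity_num_deriv a b k (- 1) (axis 1 1)) / (w ^ 3 * w ^ 3)"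
    by (simp add: J_def det_2 matrix_def velocity_deriv_def w_def[symmetric] diff_divide_distrib)
  also have "\<dots> = - 4 * a * b * jac_form a b k * w\<^sup>2 / (w ^ 3 * w ^ 3)"
    by (simp only: velocity_num_deriv_det w(2))
  also have "\<dots> = - 4 * a * b * jac_form a b k / (w\<^sup>2)\<^sup>2"
    using w(1) by (simp add: power2_eq_square power3_eq_cube)
  finally show ?thesis by (simp only: w(2))
qed

lemma abs_tau_le: "0 \<le> a \<Longrightarrow> 0 \<le> b \<Longrightarrow> \<bar>tau a b k\<bar> \<le> a + b"
proof -
  assume ab: "0 \<le> a" "0 \<le> b"
  have "\<bar>tau a b k\<bar> \<le> a * \<bar>cos (k $ 2 + k $ 1)\<bar> + b * \<bar>cos (k $ 2 - k $ 1)\<bar>"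
    unfolding tau_def using ab by (metis abs_triangle_ineq4 abs_mult abs_of_nonneg)
  also have "\<dots> \<le> a * 1 + b * 1"
    using ab by (intro add_mono mult_left_mono) auto
  finally show ?thesis by simp
qed

section \<open>The velocity and the functions \<open>F\<close> and \<open>F0\<close> in terms of the
  cosines\<close>

lemma velocity_sum_power2:
  assumes "(tau a b k)\<^sup>2 < 1"
  shows "(velocity a b k $ 1 + velocity a b k $ 2)\<^sup>2
    = 4 * a\<^sup>2 * (1 - (cos (k $ 2 + k $ 1))\<^sup>2) / (1 - (tau a b k)\<^sup>2)"
proof -
  have "velocity a b k $ 1 + velocity a b k $ 2
      = - (2 * a * sin (k $ 2 + k $ 1)) / sqrt (1 - (tau a b k)\<^sup>2)"
    by (simp add: velocity_def flip: add_divide_distrib)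
  then show ?thesis
    using assms by (simp add: power_divide power_mult_distrib sin_squared_eq)
qed

lemma velocity_diff_power2:
  assumes "(tau a b k)\<^sup>2 < 1"
  shows "(velocity a b k $ 1 - velocity a b k $ 2)\<^sup>2
    = 4 * b\<^sup>2 * (1 - (cos (k $ 2 - k $ 1))\<^sup>2) / (1 - (tau a b k)\<^sup>2)"
proof -
  have "velocity a b k $ 1 - velocity a b k $ 2
      = - (2 * b * sin (k $ 2 - k $ 1)) / sqrt (1 - (tau a b k)\<^sup>2)"
    by (simp add: velocity_def flip: diff_divide_distrib)
  then show ?thesis
    using assms by (simp add: power_divide power_mult_distrib sin_squared_eq)
qed

text \<open>Over the denominator \<open>W\<close>, the squares in each factor collapse by the
  Pythagorean identity to \<open>M + 2 * a * b * (c1 * c2 - s1 * s2)\<close> and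
  \<open>M + 2 * a * b * (c1 * c2 + s1 * s2)\<close>. Their product is a difference of two
  squares.\<close>

lemma velocity_coord_compl_prod:
  assumes "(tau a b k)\<^sup>2 < 1"
  shows "(1 - (velocity a b k $ 1)\<^sup>2) * (1 - (velocity a b k $ 2)\<^sup>2)
    = ((1 - a\<^sup>2 - b\<^sup>2)\<^sup>2 - 4 * a\<^sup>2 * b\<^sup>2 + 4 * a * b * jac_form a b k) / (1 - (tau a b k)\<^sup>2)\<^sup>2"
proof -
  define c1 c2 s1 s2 where defs: "c1 = cos (k $ 2 + k $ 1)" "c2 = cos (k $ 2 - k $ 1)"
    "s1 = sin (k $ 2 + k $ 1)" "s2 = sin (k $ 2 - k $ 1)"
  define W where "W = 1 - (tau a b k)\<^sup>2"
  have W: "W > 0" "W = 1 - (a * c1 - b * c2)\<^sup>2"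
    using assms by (simp_all add: W_def tau_def defs)
  have s: "s1\<^sup>2 = 1 - c1\<^sup>2" "s2\<^sup>2 = 1 - c2\<^sup>2"
    by (simp_all add: defs sin_squared_eq)
  have v: "(velocity a b k $ 1)\<^sup>2 = (a * s1 + b * s2)\<^sup>2 / W" "(velocity a b k $ 2)\<^sup>2 = (a * s1 - b * s2)\<^sup>2 / W"
  proof -
    have "velocity a b k $ 1 = - (a * s1 + b * s2) / sqrt W" "velocity a b k $ 2 = - (a * s1 - b * s2) / sqrt W"
      by (simp_all add: velocity_def defs W_def)
    then show "(velocity a b k $ 1)\<^sup>2 = (a * s1 + b * s2)\<^sup>2 / W" "(velocity a b k $ 2)\<^sup>2 = (a * s1 - b * s2)\<^sup>2 / W"
      using W(1) by (simp_all only: power_divide power2_minus real_sqrt_pow2 less_imp_le)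
  qed
  have cs: "c1\<^sup>2 + s1\<^sup>2 = 1" "c2\<^sup>2 + s2\<^sup>2 = 1"
    using s by simp_all
  have "W - (a * s1 + b * s2)\<^sup>2 = 1 - a\<^sup>2 * (c1\<^sup>2 + s1\<^sup>2) - b\<^sup>2 * (c2\<^sup>2 + s2\<^sup>2) + 2 * a * b * (c1 * c2 - s1 * s2)"
    "W - (a * s1 - b * s2)\<^sup>2 = 1 - a\<^sup>2 * (c1\<^sup>2 + s1\<^sup>2) - b\<^sup>2 * (c2\<^sup>2 + s2\<^sup>2) + 2 * a * b * (c1 * c2 + s1 * s2)"
    unfolding W by (simp_all add: algebra_simps power2_eq_square)
  then have "(W - (a * s1 + b * s2)\<^sup>2) * (W - (a * s1 - b * s2)\<^sup>2)
      = (1 - a\<^sup>2 - b\<^sup>2 + 2 * a * b * (c1 * c2 - s1 * s2)) * (1 - a\<^sup>2 - b\<^sup>2 + 2 * a * b * (c1 * c2 + s1 * s2))"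
    by (simp only: cs mult_1_right)
  also have "\<dots> = (1 - a\<^sup>2 - b\<^sup>2 + 2 * a * b * (c1 * c2))\<^sup>2 - 4 * a\<^sup>2 * b\<^sup>2 * (s1\<^sup>2 * s2\<^sup>2)"
    by (simp add: algebra_simps power2_eq_square)
  also have "\<dots> = (1 - a\<^sup>2 - b\<^sup>2)\<^sup>2 - 4 * a\<^sup>2 * b\<^sup>2 + 4 * a * b * jac_form a b k"
    unfolding s jac_form_def defs(1,2)[symmetric] by (simp add: algebra_simps power2_eq_square)
  finally have eq: "(W - (a * s1 + b * s2)\<^sup>2) * (W - (a * s1 - b * s2)\<^sup>2)
      = (1 - a\<^sup>2 - b\<^sup>2)\<^sup>2 - 4 * a\<^sup>2 * b\<^sup>2 + 4 * a * b * jac_form a b k" .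
  have ratio: "1 - x / W = (W - x) / W" for x
    using W(1) by (simp add: field_simps)
  show ?thesis
    unfolding v W_def[symmetric] ratio times_divide_times_eq eq power2_eq_square[of W] ..
qed

lemma coin_b_power2: "\<alpha> \<in> {0..1} \<Longrightarrow> (coin_b \<alpha>)\<^sup>2 = 1 - \<alpha>\<^sup>2"
  by (simp add: coin_b_def power_le_one)

lemma cross_sq_eq:
  assumes "a1 \<in> {0..1}" "a2 \<in> {0..1}"
  shows "cross_sq a1 a2 = 1 - (par_a a1 a2)\<^sup>2 - (par_b a1 a2)\<^sup>2"
  using assms by (simp add: cross_sq_def par_a_def par_b_def power_mult_distrib coin_b_power2 algebra_simps)

text \<open>The outer coefficients multiply to \<open>a * b\<close>, and the mixed one is
  \<open>cross_sq a1 a2 = M\<close>. The two linear factors are those whose squares appear in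
  \<open>F a1\<close> and \<open>F a2\<close>, so \<open>D = 0\<close> means that one of these
  functions vanishes.\<close>

lemma jac_form_factor:
  assumes "a1 \<in> {0..1}" "a2 \<in> {0..1}"
  shows "jac_form (par_a a1 a2) (par_b a1 a2) k =
    (a2 * coin_b a1 * cos (k $ 2 + k $ 1) + a1 * coin_b a2 * cos (k $ 2 - k $ 1)) *
    (a1 * coin_b a2 * cos (k $ 2 + k $ 1) + a2 * coin_b a1 * cos (k $ 2 - k $ 1))"
  unfolding jac_form_def cross_sq_eq[OF assms, symmetric]
  by (simp add: cross_sq_def par_a_def par_b_def algebra_simps power2_eq_square)

text \<open>Dividing by the squares of \<open>a1\<close> and \<open>coin_b a1\<close> leaves only
  the second coin as coefficients. Its entries have squares summing to 1, which removes the constant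
  term and leaves a perfect square.\<close>

lemma F_velocity:
  assumes "a1 \<in> {0..1}" "a2 \<in> {0..1}" "0 < par_a a1 a2" "0 < par_b a1 a2"
    and "(tau (par_a a1 a2) (par_b a1 a2) k)\<^sup>2 < 1"
  shows "F a1 (velocity (par_a a1 a2) (par_b a1 a2) k) =
    (a2 * coin_b a1 * cos (k $ 2 + k $ 1) + a1 * coin_b a2 * cos (k $ 2 - k $ 1))\<^sup>2
      / (1 - (tau (par_a a1 a2) (par_b a1 a2) k)\<^sup>2)"
proof -
  let ?a = "par_a a1 a2" and ?b = "par_b a1 a2"
  define c1 c2 where c: "c1 = cos (k $ 2 + k $ 1)" "c2 = cos (k $ 2 - k $ 1)"
  define W where "W = 1 - (tau ?a ?b k)\<^sup>2"
  have W: "W > 0" "W = 1 - (a1 * a2 * c1 - coin_b a1 * coin_b a2 * c2)\<^sup>2"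
    using assms by (simp_all add: W_def tau_def c par_a_def par_b_def)
  have pos: "a1 \<noteq> 0" "coin_b a1 \<noteq> 0"
    using assms by (auto simp: par_a_def par_b_def)
  have "F a1 (velocity ?a ?b k) = 1 - a2\<^sup>2 * (1 - c1\<^sup>2) / W - (coin_b a2)\<^sup>2 * (1 - c2\<^sup>2) / W"
    unfolding F_def velocity_sum_power2[OF assms(5)] velocity_diff_power2[OF assms(5)]
      W_def[symmetric] c[symmetric]
    using pos by (simp add: par_a_def par_b_def power_mult_distrib)
  also have "\<dots> = (W - a2\<^sup>2 * (1 - c1\<^sup>2) - (coin_b a2)\<^sup>2 * (1 - c2\<^sup>2)) / W"
    using W(1) by (simp add: diff_divide_distrib)
  also have "W - a2\<^sup>2 * (1 - c1\<^sup>2) - (coin_b a2)\<^sup>2 * (1 - c2\<^sup>2)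
      = (1 - a2\<^sup>2 - (coin_b a2)\<^sup>2) + a2\<^sup>2 * c1\<^sup>2 * (1 - a1\<^sup>2) + (coin_b a2)\<^sup>2 * c2\<^sup>2 * (1 - (coin_b a1)\<^sup>2)
        + 2 * (a1 * a2 * c1 * coin_b a1 * coin_b a2 * c2)"
    unfolding W(2) by (simp add: algebra_simps power2_eq_square)
  also have "\<dots> = (a2 * coin_b a1 * c1 + a1 * coin_b a2 * c2)\<^sup>2"
  proof -
    have "1 - a2\<^sup>2 - (coin_b a2)\<^sup>2 = 0" "1 - a1\<^sup>2 = (coin_b a1)\<^sup>2" "1 - (coin_b a1)\<^sup>2 = a1\<^sup>2"
      using coin_b_power2[OF assms(2)] coin_b_power2[OF assms(1)] by simp_all
    then show ?thesis
      by (simp only:) (simp add: power2_sum power_mult_distrib)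
  qed
  finally show ?thesis by (simp add: W_def c)
qed

lemma F0_velocity:
  assumes "a1 \<in> {0..1}" "a2 \<in> {0..1}" and a: "a = par_a a1 a2" and b: "b = par_b a1 a2"
    and pos: "0 < a" "0 < b" and t: "(tau a b k)\<^sup>2 < 1"
  shows "F0 a1 a2 (velocity a b k) =
    (((1 - a\<^sup>2 - b\<^sup>2)\<^sup>2 - 4 * a\<^sup>2 * b\<^sup>2) / (2 * a * b) + jac_form a b k) / (1 - (tau a b k)\<^sup>2)"
proof -
  define c1 c2 where c: "c1 = cos (k $ 2 + k $ 1)" "c2 = cos (k $ 2 - k $ 1)"
  define W where "W = 1 - (tau a b k)\<^sup>2"
  have W: "W > 0" "W = 1 - (a * c1 - b * c2)\<^sup>2"
    using t by (simp_all add: W_def tau_def c)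
  define M where "M = cross_sq a1 a2"
  have M: "M = 1 - a\<^sup>2 - b\<^sup>2"
    using cross_sq_eq[OF assms(1,2)] by (simp add: M_def a b)
  have nz: "a1 \<noteq> 0" "a2 \<noteq> 0" "coin_b a1 \<noteq> 0" "coin_b a2 \<noteq> 0"
    using pos by (auto simp: a b par_a_def par_b_def)
  then have "M > 0"
    unfolding M_def cross_sq_def by (intro add_pos_pos) auto
  \<comment> \<open>\<open>A\<close> carries the dependence on the individual coins:
    \<open>a0_sq\<close> is \<open>M / (2 - A)\<close> and \<open>b0_sq\<close> is
    \<open>M / A\<close>.\<close>
  define A where "A = a1\<^sup>2 + a2\<^sup>2"
  have A: "A \<noteq> 0" "M = A - 2 * a\<^sup>2" "b\<^sup>2 = 1 - A + a\<^sup>2" "(coin_b a1)\<^sup>2 + (coin_b a2)\<^sup>2 = 2 - A"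
    using assms(1,2) nz by (auto simp: A_def M_def cross_sq_def a b par_a_def par_b_def
        power_mult_distrib coin_b_power2 algebra_simps)
  have scale: "4 * x * y / W / (4 * (M / B)) = x * y * B / (M * W)" for x y B
    by (simp add: ac_simps)
  have "F0 a1 a2 (velocity a b k) = M / (2 * a * b) *
      (1 - a\<^sup>2 * (1 - c1\<^sup>2) * (2 - A) / (M * W) - b\<^sup>2 * (1 - c2\<^sup>2) * A / (M * W))"
    unfolding F0_def velocity_sum_power2[OF t] velocity_diff_power2[OF t] a0_sq_def b0_sq_def
      W_def[symmetric] c[symmetric] M_def[symmetric] a[symmetric] b[symmetric] A(4) A_def[symmetric]
      scale ..
  also have "\<dots> = (M * W - a\<^sup>2 * (1 - c1\<^sup>2) * (2 - A) - b\<^sup>2 * (1 - c2\<^sup>2) * A) / (2 * a * b) / W"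
    using W(1) \<open>M > 0\<close> pos by (simp add: field_simps)
  also have "M * W - a\<^sup>2 * (1 - c1\<^sup>2) * (2 - A) - b\<^sup>2 * (1 - c2\<^sup>2) * A
      = M\<^sup>2 - 4 * a\<^sup>2 * b\<^sup>2 + 2 * a * b * (a * b * (c1\<^sup>2 + c2\<^sup>2) + M * (c1 * c2))"
  proof -
    \<comment> \<open>These relations eliminate \<open>A\<close>. Writing the constant 1 in
      \<open>W\<close> as \<open>M + a\<^sup>2 + b\<^sup>2\<close> then makes the claim a polynomial
      identity in \<open>M\<close>, \<open>a\<close>, \<open>b\<close>, \<open>c1\<close>,
      \<open>c2\<close>.\<close>
    have MA: "2 - A = M + 2 * b\<^sup>2" "A = M + 2 * a\<^sup>2" "1 = M + a\<^sup>2 + b\<^sup>2"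
      using A M by auto
    have "M * W = M * 1 - M * (a * c1 - b * c2)\<^sup>2"
      unfolding W(2) by (rule right_diff_distrib)
    also have "M * 1 = M * (M + a\<^sup>2 + b\<^sup>2)"
      by (simp only: MA(3)[symmetric])
    finally show ?thesis
      unfolding MA(1) unfolding MA(2) by (simp add: algebra_simps power2_eq_square)
  qed
  also have "\<dots> = M\<^sup>2 - 4 * a\<^sup>2 * b\<^sup>2 + 2 * a * b * jac_form a b k"
    by (simp add: jac_form_def M c)
  also have "\<dots> / (2 * a * b) / W = ((M\<^sup>2 - 4 * a\<^sup>2 * b\<^sup>2) / (2 * a * b) + jac_form a b k) / W"
    using pos by (simp add: add_divide_distrib)
  finally show ?thesis by (simp add: M W_def)
qed

section \<open>Oddness, periodicity and the topology of the image of the velocity map\<close>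

lemma tau_uminus: "tau a b (- k) = tau a b k"
proof -
  have "(- k) $ 2 + (- k) $ 1 = - (k $ 2 + k $ 1)" "(- k) $ 2 - (- k) $ 1 = - (k $ 2 - k $ 1)"
    by simp_all
  then show ?thesis by (simp only: tau_def cos_minus)
qed

lemma velocity_uminus: "velocity a b (- k) = - velocity a b k"
proof -
  have "(- k) $ 2 + (- k) $ 1 = - (k $ 2 + k $ 1)" "(- k) $ 2 - (- k) $ 1 = - (k $ 2 - k $ 1)"
    by simp_all
  then show ?thesis
    unfolding velocity_def tau_uminus
    by (simp only: sin_minus) (simp add: vec_eq_iff forall_2 add_divide_distrib diff_divide_distrib)
qed

lemma regular_uminus: "- k \<in> regular a b \<longleftrightarrow> k \<in> regular a b"
  by (simp add: regular_def tau_uminus)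

lemma Sigma_v_eq: "Sigma_v a b = closure (velocity a b ` regular a b)"
proof -
  have "(\<lambda>k. - velocity a b k) ` regular a b \<subseteq> velocity a b ` regular a b"
    by (auto simp: image_iff velocity_uminus regular_uminus intro!: bexI[of _ "- _"])
  then show ?thesis by (simp add: Sigma_v_def Un_absorb2)
qed

lemma velocity_shift:
  "velocity a b (\<chi> i. k $ i + of_int (n i) * (2 * pi)) = velocity a b k"
proof -
  have plus: "(k $ 2 + of_int (n 2) * (2 * pi)) + (k $ 1 + of_int (n 1) * (2 * pi))
      = (k $ 2 + k $ 1) + of_int (n 2 + n 1) * (2 * pi)"
    and minus: "(k $ 2 + of_int (n 2) * (2 * pi)) - (k $ 1 + of_int (n 1) * (2 * pi))
      = (k $ 2 - k $ 1) + of_int (n 2 - n 1) * (2 * pi)"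
    by (simp_all add: algebra_simps)
  have periodic: "sin (x + of_int m * (2 * pi)) = sin x" "cos (x + of_int m * (2 * pi)) = cos x" for x m
    using sin.plus_of_int[of x m] cos.plus_of_int[of x m] by simp_all
  show ?thesis
    unfolding velocity_def tau_def vec_lambda_beta plus minus periodic ..
qed

text \<open>By periodicity in each coordinate all values are already taken on the compact square
  \<open>Q\<close>, where the velocity is continuous.\<close>

lemma compact_range_velocity:
  assumes "\<And>k. (tau a b k)\<^sup>2 < 1"
  shows "compact (range (velocity a b))"
proof -
  define Q :: "(real ^ 2) set" where "Q = cbox 0 (\<chi> i. 2 * pi)"
  have "velocity a b k \<in> velocity a b ` Q" for k
  proof (rule image_eqI)
    let ?n = "\<lambda>i. - \<lfloor>k $ i / (2 * pi)\<rfloor>"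
    show "velocity a b k = velocity a b (\<chi> i. k $ i + of_int (?n i) * (2 * pi))"
      by (rule velocity_shift[symmetric])
    have "0 \<le> x + of_int (- \<lfloor>x / (2 * pi)\<rfloor>) * (2 * pi)"
      "x + of_int (- \<lfloor>x / (2 * pi)\<rfloor>) * (2 * pi) \<le> 2 * pi" for x
      using floor_divide_lower[of "2 * pi" x] floor_divide_upper[of "2 * pi" x]
      by (simp_all add: algebra_simps)
    then show "(\<chi> i. k $ i + of_int (?n i) * (2 * pi)) \<in> Q"
      by (simp add: Q_def mem_box_cart)
  qed
  then have "range (velocity a b) = velocity a b ` Q" by auto
  moreover have "continuous_on Q (velocity a b)"
    using has_derivative_continuous[OF velocity_has_derivative[OF assms]]
    by (intro continuous_at_imp_continuous_on) auto
  ultimately show ?thesis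
    by (simp add: Q_def compact_continuous_image)
qed

text \<open>A nonzero determinant gives the derivative a linear right inverse, as Sussmann's open
  mapping theorem requires.\<close>

lemma velocity_interior:
  assumes t: "\<And>k. (tau a b k)\<^sup>2 < 1" and "J a b k \<noteq> 0"
  shows "velocity a b k \<in> interior (range (velocity a b))"
proof -
  define A where "A = matrix (velocity_deriv a b k)"
  have deriv: "(velocity a b has_derivative velocity_deriv a b k) (at k)"
    by (rule velocity_has_derivative[OF t])
  then have A: "velocity_deriv a b k = (*v) A"
    using has_derivative_linear by (auto simp: A_def matrix_works)
  have "J a b k = det A"
    using frechet_derivative_at[OF deriv] by (simp add: J_def jacobian_def A_def)
  then obtain B where "A ** B = mat 1"
    using assms(2) invertible_det_nz[of A] by (auto simp: invertible_def)
  then have "velocity_deriv a b k \<circ> (*v) B = id"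
    by (simp add: A fun_eq_iff matrix_vector_mul_assoc)
  then show ?thesis
    using has_derivative_continuous[OF velocity_has_derivative[OF t]]
    by (intro sussmann_open_mapping[OF _ _ _ deriv, of UNIV])
      (auto intro: continuous_at_imp_continuous_on)
qed

section \<open>A boundary criterion, and divergence of weighted sums of densities\<close>

lemma F_scaleR: "F \<alpha> (c *\<^sub>R v) = 1 - c\<^sup>2 * (1 - F \<alpha> v)"
proof -
  have "(c * x + c * y)\<^sup>2 = c\<^sup>2 * (x + y)\<^sup>2" "(c * x - c * y)\<^sup>2 = c\<^sup>2 * (x - y)\<^sup>2" for x y
    by (simp_all add: power_mult_distrib flip: distrib_left right_diff_distrib)
  then show ?thesis
    unfolding F_def vector_scaleR_component real_scaleR_def by (simp add: right_diff_distrib distrib_left)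
qed

lemma F_zero_not_interior:
  assumes "S \<subseteq> E \<alpha>" "F \<alpha> v = 0"
  shows "v \<notin> interior S"
proof
  assume "v \<in> interior S"
  then obtain e where e: "e > 0" "ball v e \<subseteq> S"
    by (auto simp: mem_interior)
  \<comment> \<open>Moves \<open>v\<close> by less than \<open>e\<close>; the summand 1 keeps the
    denominator positive.\<close>
  define \<delta> where "\<delta> = e / (2 * (norm v + 1))"
  have "norm v + 1 > 0" by (simp add: add_nonneg_pos)
  then have \<delta>: "\<delta> > 0" "\<delta> * norm v < e"
    using e(1) by (simp_all add: \<delta>_def field_simps) (smt (verit) mult_nonneg_nonneg norm_ge_zero)
  then have "(1 + \<delta>) *\<^sub>R v \<in> ball v e"
    by (simp add: dist_norm scaleR_add_left)
  then have "0 \<le> F \<alpha> ((1 + \<delta>) *\<^sub>R v)"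
    using e(2) assms(1) by (auto simp: E_def)
  moreover have "(1 + \<delta>)\<^sup>2 > 1"
    using \<delta>(1) by (simp add: one_less_power)
  ultimately show False
    by (simp add: F_scaleR assms(2))
qed

text \<open>Only the total weight is bounded below by \<open>c\<close>, and either weight may
  vanish. Therefore both densities are pushed above \<open>Z / c\<close>, so that the weighted sum
  exceeds \<open>Z\<close> however the weight is split.\<close>

lemma diverges_on_weighted:
  assumes f: "diverges_on C \<Sigma> (\<lambda>v. 1) f" and g: "diverges_on C \<Sigma> (\<lambda>v. 1) g"
    and nonneg: "\<And>v. 0 \<le> u v" "\<And>v. 0 \<le> w v"
  shows "diverges_on C \<Sigma> (\<lambda>v. u v + w v) (\<lambda>v. u v * f v + w v * g v)"
  unfolding diverges_on_def
proof (intro ballI allI impI)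
  fix v0 S assume v0: "v0 \<in> C" and S: "S \<subseteq> \<Sigma> - C" and "\<exists>c>0. \<forall>v\<in>S. c \<le> u v + w v"
  then obtain c where c: "c > 0" "\<And>v. v \<in> S \<Longrightarrow> c \<le> u v + w v" by auto
  have lim: "filterlim f at_top (at v0 within S)" "filterlim g at_top (at v0 within S)"
    using f g v0 S unfolding diverges_on_def by (metis order_refl zero_less_one)+
  show "filterlim (\<lambda>v. u v * f v + w v * g v) at_top (at v0 within S)"
    \<comment> \<open>With \<open>Z\<close> positive, \<open>Z / c\<close> is nonnegative, as the
      monotonicity step below needs.\<close>
    unfolding filterlim_at_top_gt[where c = 0]
  proof (intro allI impI)
    fix Z :: real assume Z: "0 < Z"
    have "eventually (\<lambda>v. Z / c \<le> f v) (at v0 within S)" "eventually (\<lambda>v. Z / c \<le> g v) (at v0 within S)"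
      using lim by (auto simp: filterlim_at_top)
    moreover have "eventually (\<lambda>v. v \<in> S) (at v0 within S)"
      by (simp add: eventually_at_filter)
    ultimately show "eventually (\<lambda>v. Z \<le> u v * f v + w v * g v) (at v0 within S)"
    proof eventually_elim
      case (elim v)
      have "Z = c * (Z / c)" using c(1) by simp
      also have "\<dots> \<le> (u v + w v) * (Z / c)"
        using c elim Z by (intro mult_right_mono) auto
      also have "\<dots> \<le> u v * f v + w v * g v"
        unfolding distrib_right using elim nonneg by (intro add_mono mult_left_mono) auto
      finally show ?case .
    qed
  qed
qed

lemma continuous_on_F: "continuous_on S (F \<alpha>)"
  unfolding F_def divide_inverse by (intro continuous_intros)

lemma continuous_on_F0: "continuous_on S (F0 a1 a2)"
  unfolding F0_def divide_inverse by (intro continuous_intros)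

lemma tendsto_at_within_continuous_on_UNIV:
  assumes "continuous_on UNIV f"
  shows "(f \<longlongrightarrow> f x) (at x within S)"
  using assms continuous_on_subset[of UNIV f S]
  by (meson UNIV_I continuous_on_def tendsto_within_subset subset_UNIV)

section \<open>The case \<open>a + b < 1\<close>: densities, boundary and caustic\<close>

lemma subcritical_tau:
  assumes "0 < a" "0 < b" "a + b < 1"
  shows "(tau a b k)\<^sup>2 < 1"
  using abs_tau_le[of a b k] assms by (simp add: abs_square_less_1)

lemma subcritical_gap:
  fixes a b :: real
  assumes "0 < a" "0 < b" "a + b < 1"
  shows "2 * a * b < 1 - a\<^sup>2 - b\<^sup>2"
proof -
  have "(a + b)\<^sup>2 < 1" using assms by (simp add: abs_square_less_1)
  then show ?thesis by (simp add: power2_sum)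
qed

text \<open>\<open>D = (M - 2 * a * b) * (c1 * c2) + a * b * (c1 + c2)\<^sup>2\<close>, where the
  last term is nonnegative and \<open>c1 * c2\<close> is at least -1.\<close>

lemma jac_form_lower:
  assumes "0 \<le> a" "0 \<le> b" "2 * a * b \<le> 1 - a\<^sup>2 - b\<^sup>2"
  shows "- (1 - a\<^sup>2 - b\<^sup>2 - 2 * a * b) \<le> jac_form a b k"
proof -
  define M where "M = 1 - a\<^sup>2 - b\<^sup>2"
  define c1 c2 where c: "c1 = cos (k $ 2 + k $ 1)" "c2 = cos (k $ 2 - k $ 1)"
  have "- 1 \<le> c1 * c2"
    using mult_mono[of "\<bar>c1\<bar>" 1 "\<bar>c2\<bar>" 1] by (simp add: c abs_le_iff flip: abs_mult)
  then have "- (M - 2 * a * b) \<le> (M - 2 * a * b) * (c1 * c2)"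
    using assms(3) mult_left_mono[of "-1" "c1 * c2" "M - 2 * a * b"] by (simp add: M_def)
  also have "\<dots> \<le> (M - 2 * a * b) * (c1 * c2) + a * b * (c1 + c2)\<^sup>2"
    using assms by simp
  also have "\<dots> = jac_form a b k"
    by (simp add: jac_form_def M_def c power2_sum algebra_simps)
  finally show ?thesis by (simp add: M_def)
qed

text \<open>At the lower bound for \<open>D\<close> the numerator in
  \<open>velocity_coord_compl_prod\<close> becomes the square of \<open>M - 2 * a * b\<close>, which
  is positive.\<close>

lemma subcritical_compl_pos:
  assumes "0 < a" "0 < b" "a + b < 1"
  shows "0 < (1 - (velocity a b k $ 1)\<^sup>2) * (1 - (velocity a b k $ 2)\<^sup>2)"
proof -
  define M where "M = 1 - a\<^sup>2 - b\<^sup>2"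
  have M: "2 * a * b < M"
    using subcritical_gap[OF assms] by (simp add: M_def)
  have "0 < (M - 2 * a * b)\<^sup>2" using M by simp
  also have "\<dots> = M\<^sup>2 - 4 * a\<^sup>2 * b\<^sup>2 + 4 * a * b * - (M - 2 * a * b)"
    by (simp add: power2_eq_square algebra_simps)
  also have "\<dots> \<le> M\<^sup>2 - 4 * a\<^sup>2 * b\<^sup>2 + 4 * a * b * jac_form a b k"
    using jac_form_lower[of a b k] assms(1,2) M
    by (intro add_left_mono mult_left_mono) (auto simp: M_def)
  finally show ?thesis
    using subcritical_tau[OF assms, of k]
    unfolding velocity_coord_compl_prod[OF subcritical_tau[OF assms]] M_def by simp
qed

lemma Sing_eq:
  assumes "0 < a" "0 < b" "\<And>k. k \<in> regular a b \<Longrightarrow> (tau a b k)\<^sup>2 < 1"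
  shows "Sing a b = {k \<in> regular a b. jac_form a b k = 0}"
proof -
  have "J a b k = 0 \<longleftrightarrow> jac_form a b k = 0" if "k \<in> regular a b" for k
    using assms(1,2) assms(3)[OF that] by (simp add: J_eq)
  then show ?thesis by (auto simp: Sing_def)
qed

locale subcritical =
  fixes a1 a2 a b :: real
  assumes range1: "a1 \<in> {0..1}" and range2: "a2 \<in> {0..1}"
    and a: "a = par_a a1 a2" and b: "b = par_b a1 a2"
    and a_pos: "0 < a" and b_pos: "0 < b" and ab: "a + b < 1"
begin

lemmas tau = subcritical_tau[OF a_pos b_pos ab]
lemmas compl_pos = subcritical_compl_pos[OF a_pos b_pos ab]

lemma regular_eq: "regular a b = UNIV"
  using tau by (auto simp: regular_def less_le)

lemma Sing: "Sing a b = {k. jac_form a b k = 0}"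
  using Sing_eq[of a b] a_pos b_pos tau by (simp add: regular_eq)

lemma Sigma_v: "Sigma_v a b = range (velocity a b)"
  using compact_range_velocity[OF tau] by (simp add: Sigma_v_eq regular_eq compact_imp_closed)

lemma F1: "F a1 (velocity a b k) =
    (a2 * coin_b a1 * cos (k $ 2 + k $ 1) + a1 * coin_b a2 * cos (k $ 2 - k $ 1))\<^sup>2
      / (1 - (tau a b k)\<^sup>2)"
  unfolding a b by (rule F_velocity) (use range1 range2 a_pos b_pos tau in \<open>auto simp: a b\<close>)

lemma F2: "F a2 (velocity a b k) =
    (a1 * coin_b a2 * cos (k $ 2 + k $ 1) + a2 * coin_b a1 * cos (k $ 2 - k $ 1))\<^sup>2
      / (1 - (tau a b k)\<^sup>2)"
proof -
  \<comment> \<open>Exchanging the coins preserves \<open>a\<close> and \<open>b\<close>.\<close>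
  have "a = par_a a2 a1" "b = par_b a2 a1" by (simp_all add: a b par_a_def par_b_def)
  then show ?thesis
    using F_velocity[of a2 a1 k] range1 range2 a_pos b_pos tau by simp
qed

lemma range_velocity_subset: "range (velocity a b) \<subseteq> E a1 \<inter> E a2"
  using tau by (auto simp: E_def F1 F2 less_imp_le)

lemma F_prod: "F a1 (velocity a b k) * F a2 (velocity a b k)
    = (jac_form a b k / (1 - (tau a b k)\<^sup>2))\<^sup>2"
  unfolding F1 F2 jac_form_factor[OF range1 range2, of k, folded a b]
  by (simp add: power_mult_distrib power_divide flip: power2_eq_square)

text \<open>The common form of both densities. The square root of \<open>F a1 v * F a2 v\<close> is
  \<open>\<bar>D\<bar> / W\<close>, so \<open>f_plus\<close> for \<open>D > 0\<close> and
  \<open>f_minus\<close> for \<open>D < 0\<close> both have the numerator \<open>F0 + D / W\<close>.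
  This is \<open>P / (2 * a * b) / W\<close>, and \<open>P\<close> cancels against the numerator of
  the product of the complements.\<close>

lemma density_velocity:
  defines "W \<equiv> \<lambda>k. 1 - (tau a b k)\<^sup>2"
  assumes "jac_form a b k \<noteq> 0"
  shows "pi\<^sup>2 * ((F0 a1 a2 (velocity a b k) + jac_form a b k / W k) /
      (2 * pi\<^sup>2 * (1 - (velocity a b k $ 1)\<^sup>2) * (1 - (velocity a b k $ 2)\<^sup>2) * (\<bar>jac_form a b k\<bar> / W k)))
    = 1 / \<bar>J a b k\<bar>"
proof -
  define P where "P = (1 - a\<^sup>2 - b\<^sup>2)\<^sup>2 - 4 * a\<^sup>2 * b\<^sup>2 + 4 * a * b * jac_form a b k"
  have W: "W k > 0" using tau by (simp add: W_def)
  have PW: "(1 - (velocity a b k $ 1)\<^sup>2) * (1 - (velocity a b k $ 2)\<^sup>2) = P / (W k)\<^sup>2"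
    using velocity_coord_compl_prod[OF tau] by (simp add: P_def W_def)
  then have P: "P \<noteq> 0"
    using compl_pos[of k] by auto
  have F0: "F0 a1 a2 (velocity a b k) + jac_form a b k / W k = P / (2 * a * b) / W k"
    using F0_velocity[OF range1 range2 a b a_pos b_pos tau, of k] a_pos b_pos
    by (simp add: P_def W_def add_divide_distrib)
  have J: "\<bar>J a b k\<bar> = 4 * a * b * \<bar>jac_form a b k\<bar> / (W k)\<^sup>2"
    using a_pos b_pos by (simp add: J_eq[OF tau] W_def abs_mult)
  have "pi\<^sup>2 * (P / (2 * a * b) / W k / (2 * pi\<^sup>2 * (P / (W k)\<^sup>2) * (\<bar>jac_form a b k\<bar> / W k)))
      = 1 / (4 * a * b * \<bar>jac_form a b k\<bar> / (W k)\<^sup>2)"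
    using W P assms(2) a_pos b_pos by (simp add: field_simps power2_eq_square)
  then show ?thesis
    by (simp only: F0 J mult.assoc[of "2 * pi\<^sup>2"] PW)
qed

lemma sqrt_F_prod: "sqrt (F a1 (velocity a b k) * F a2 (velocity a b k))
    = \<bar>jac_form a b k\<bar> / (1 - (tau a b k)\<^sup>2)"
  using tau[of k] by (simp add: F_prod abs_divide)

lemma indicator_velocity: "indicator (E a1 \<inter> E a2) (velocity a b k) = (1 :: real)"
  using range_velocity_subset by (auto simp: indicator_def)

lemma J_neg_iff: "J a b k < 0 \<longleftrightarrow> 0 < jac_form a b k"
  and J_pos_iff: "0 < J a b k \<longleftrightarrow> jac_form a b k < 0"
  using a_pos b_pos tau[of k]
  by (simp_all add: J_eq zero_less_mult_iff mult_less_0_iff divide_less_0_iff zero_less_divide_iff)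

lemma f_plus_velocity: "J a b k < 0 \<Longrightarrow> 1 / \<bar>J a b k\<bar> = pi\<^sup>2 * f_plus a1 a2 (velocity a b k)"
  using density_velocity[of k] by (simp add: J_neg_iff f_plus_def sqrt_F_prod indicator_velocity)

lemma f_minus_velocity: "J a b k > 0 \<Longrightarrow> 1 / \<bar>J a b k\<bar> = pi\<^sup>2 * f_minus a1 a2 (velocity a b k)"
  using density_velocity[of k] by (simp add: J_pos_iff f_minus_def sqrt_F_prod indicator_velocity)

lemma frontier_Sigma_v: "velocity a b ` Sing a b = frontier (Sigma_v a b)"
proof
  have "velocity a b k \<notin> interior (range (velocity a b))" if "k \<in> Sing a b" for k
  proof -
    have "F a1 (velocity a b k) * F a2 (velocity a b k) = 0"
      using that by (simp add: Sing F_prod)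
    then show ?thesis
      using F_zero_not_interior[of _ a1] F_zero_not_interior[of _ a2] range_velocity_subset by fastforce
  qed
  then show "velocity a b ` Sing a b \<subseteq> frontier (Sigma_v a b)"
    using closure_subset by (fastforce simp: frontier_def Sigma_v)
  \<comment> \<open>Since the image is closed, each frontier point has a preimage, and
    \<open>velocity_interior\<close> forces \<open>J = 0\<close> there.\<close>
  have "frontier (Sigma_v a b) \<subseteq> range (velocity a b) - interior (range (velocity a b))"
    using compact_range_velocity[OF tau] by (simp add: frontier_def Sigma_v compact_imp_closed)
  also have "\<dots> \<subseteq> velocity a b ` Sing a b"
    using velocity_interior[OF tau] by (auto simp: Sing_def regular_eq)
  finally show "frontier (Sigma_v a b) \<subseteq> velocity a b ` Sing a b" .
qed

text \<open>\<open>\<sigma>\<close> is 1 for \<open>f_plus\<close> and -1 for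
  \<open>f_minus\<close>. The square root vanishes at a singular velocity, so for either sign the
  numerator tends to \<open>F0 a1 a2 v0\<close>, while the denominator tends to 0 through positive
  values.\<close>

lemma diverges_on_caustic:
  "diverges_on (velocity a b ` Sing a b) (Sigma_v a b) (\<lambda>v. 1)
    (\<lambda>v. (F0 a1 a2 v + \<sigma> * sqrt (F a1 v * F a2 v)) /
     (2 * pi\<^sup>2 * (1 - (v $ 1)\<^sup>2) * (1 - (v $ 2)\<^sup>2) * sqrt (F a1 v * F a2 v))
     * indicator (E a1 \<inter> E a2) v)"
  unfolding diverges_on_def
proof (intro ballI allI impI)
  fix v0 S assume "v0 \<in> velocity a b ` Sing a b" and S: "S \<subseteq> Sigma_v a b - velocity a b ` Sing a b"
  then obtain k0 where k0: "v0 = velocity a b k0" "jac_form a b k0 = 0"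
    by (auto simp: Sing)
  let ?r = "\<lambda>v. sqrt (F a1 v * F a2 v)"
  let ?d = "\<lambda>v::real^2. 2 * pi\<^sup>2 * (1 - (v $ 1)\<^sup>2) * (1 - (v $ 2)\<^sup>2) * ?r v"
  \<comment> \<open>At \<open>D = 0\<close> only the constant
    \<open>(M\<^sup>2 - 4 * a\<^sup>2 * b\<^sup>2) / (2 * a * b)\<close> remains over
    \<open>W\<close>, and it is positive because \<open>2 * a * b < M\<close>.\<close>
  have F0_pos: "0 < F0 a1 a2 v0"
  proof -
    have "(2 * a * b)\<^sup>2 < (1 - a\<^sup>2 - b\<^sup>2)\<^sup>2"
      using subcritical_gap[OF a_pos b_pos ab] a_pos b_pos by (intro power_strict_mono) auto
    then show ?thesis
      unfolding k0(1) F0_velocity[OF range1 range2 a b a_pos b_pos tau] k0(2)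
      using a_pos b_pos tau[of k0] by (simp add: power_mult_distrib)
  qed
  have r0: "?r v0 = 0"
    unfolding k0(1) sqrt_F_prod k0(2) by simp
  have "continuous_on UNIV (\<lambda>v. F0 a1 a2 v + \<sigma> * ?r v)" "continuous_on UNIV ?d"
    by (intro continuous_intros continuous_on_F continuous_on_F0)+
  then have lim: "((\<lambda>v. F0 a1 a2 v + \<sigma> * ?r v) \<longlongrightarrow> F0 a1 a2 v0) (at v0 within S)"
      "(?d \<longlongrightarrow> 0) (at v0 within S)"
    using tendsto_at_within_continuous_on_UNIV[of _ v0 S] r0 by fastforce+
  have in_S: "eventually (\<lambda>v. v \<in> S) (at v0 within S)"
    by (simp add: eventually_at_filter)
  have good: "0 < ?d v" "indicator (E a1 \<inter> E a2) v = (1::real)" if "v \<in> S" for v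
  proof -
    \<comment> \<open>A point of the spectrum outside the caustic has only nonsingular
      preimages.\<close>
    obtain k where k: "v = velocity a b k" "jac_form a b k \<noteq> 0"
      using S \<open>v \<in> S\<close> unfolding Sigma_v Sing by blast
    have r: "0 < ?r v"
      using tau[of k] k(2) by (simp only: k(1) sqrt_F_prod) simp
    have prod: "0 < (1 - (v $ 1)\<^sup>2) * (1 - (v $ 2)\<^sup>2)"
      by (simp only: k(1) compl_pos)
    have "0 < 2 * pi\<^sup>2" by simp
    then have "0 < 2 * pi\<^sup>2 * ((1 - (v $ 1)\<^sup>2) * (1 - (v $ 2)\<^sup>2)) * ?r v"
      by (rule mult_pos_pos[OF mult_pos_pos[OF _ prod] r])
    then show "0 < ?d v" by (simp only: mult.assoc)
    show "indicator (E a1 \<inter> E a2) v = (1::real)"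
      by (simp only: k(1) indicator_velocity)
  qed
  have lim_quotient: "filterlim (\<lambda>v. (F0 a1 a2 v + \<sigma> * ?r v) / ?d v) at_top (at v0 within S)"
    by (rule LIM_at_top_divide[OF lim(1) F0_pos lim(2) eventually_mono[OF in_S good(1)]])
  have "eventually (\<lambda>v. (F0 a1 a2 v + \<sigma> * ?r v) / ?d v
      = (F0 a1 a2 v + \<sigma> * ?r v) / ?d v * indicator (E a1 \<inter> E a2) v) (at v0 within S)"
    by (rule eventually_mono[OF in_S]) (simp only: good(2) mult_1_right)
  from iffD1[OF filterlim_cong[OF refl refl this] lim_quotient]
  show "filterlim (\<lambda>v. (F0 a1 a2 v + \<sigma> * ?r v) / ?d v * indicator (E a1 \<inter> E a2) v)
      at_top (at v0 within S)" .
qed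

lemma diverges_on_f_plus: "diverges_on (velocity a b ` Sing a b) (Sigma_v a b) (\<lambda>v. 1) (f_plus a1 a2)"
  using diverges_on_caustic[of 1] by (simp add: f_plus_def[abs_def])

lemma diverges_on_f_minus: "diverges_on (velocity a b ` Sing a b) (Sigma_v a b) (\<lambda>v. 1) (f_minus a1 a2)"
  using diverges_on_caustic[of "- 1"] by (simp add: f_minus_def[abs_def])

lemma diverges_on_limit:
  assumes "\<And>v. 0 \<le> u v" "\<And>v. 0 \<le> w v"
  shows "diverges_on (velocity a b ` Sing a b) (Sigma_v a b) (\<lambda>v. u v + w v)
    (\<lambda>v. u v * f_plus a1 a2 v + w v * f_minus a1 a2 v)"
  by (rule diverges_on_weighted[OF diverges_on_f_plus diverges_on_f_minus assms])

end

section \<open>The case \<open>a + b = 1\<close>: the ellipse and its four contact points\<close>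

locale critical =
  fixes a b :: real
  assumes a_pos: "0 < a" and b_pos: "0 < b" and ab: "a + b = 1"
begin

definition corners :: "(real ^ 2) set" where
  "corners = {vector [1, a - b], - vector [1, a - b], vector [a - b, 1], - vector [a - b, 1]}"

lemma tau: "k \<in> regular a b \<Longrightarrow> (tau a b k)\<^sup>2 < 1"
  using abs_tau_le[of a b k] a_pos b_pos ab by (auto simp: regular_def less_le abs_square_le_1)

lemma gap: "1 - a\<^sup>2 - b\<^sup>2 = 2 * a * b"
  using arg_cong[OF ab, of "\<lambda>x. x\<^sup>2"] by (simp add: power2_sum)

lemma jac_form: "jac_form a b k = a * b * (cos (k $ 2 + k $ 1) + cos (k $ 2 - k $ 1))\<^sup>2"
  unfolding jac_form_def gap by (simp add: power2_sum algebra_simps)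

lemma compl_prod:
  assumes "k \<in> regular a b"
  shows "(1 - (velocity a b k $ 1)\<^sup>2) * (1 - (velocity a b k $ 2)\<^sup>2) = \<bar>J a b k\<bar>"
proof -
  have "0 \<le> jac_form a b k" using a_pos b_pos by (simp add: jac_form)
  then show ?thesis
    using a_pos b_pos unfolding velocity_coord_compl_prod[OF tau[OF assms]] J_eq[OF tau[OF assms]] gap
    by (simp add: power_mult_distrib abs_mult)
qed

lemma velocity_in_E_crit:
  assumes "k \<in> regular a b"
  shows "velocity a b k \<in> E_crit a b"
proof -
  define c1 c2 where c: "c1 = cos (k $ 2 + k $ 1)" "c2 = cos (k $ 2 - k $ 1)"
  define W where "W = 1 - (tau a b k)\<^sup>2"
  have W: "W > 0" "W = 1 - (a * c1 - b * c2)\<^sup>2"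
    using tau[OF assms] by (simp_all add: W_def tau_def c)
  have b: "b = 1 - a" using ab by simp
  \<comment> \<open>The slack in the ellipse inequality is \<open>D / W\<close>.\<close>
  have "W - a * (1 - c1\<^sup>2) - b * (1 - c2\<^sup>2) = a * b * (c1 + c2)\<^sup>2"
    unfolding W b by (simp add: algebra_simps power2_eq_square)
  moreover have "0 \<le> a * b * (c1 + c2)\<^sup>2" using a_pos b_pos by simp
  ultimately have "a * (1 - c1\<^sup>2) + b * (1 - c2\<^sup>2) \<le> W" by linarith
  then show ?thesis
    unfolding E_crit_def mem_Collect_eq velocity_sum_power2[OF tau[OF assms]]
      velocity_diff_power2[OF tau[OF assms]] W_def[symmetric] c[symmetric]
    using W(1) a_pos b_pos by (simp add: power2_eq_square flip: add_divide_distrib)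
qed

text \<open>Completing the square in the ellipse equation along one coordinate. If that coordinate
  is 1 or -1, the linear form on the left vanishes and determines the other coordinate.\<close>

lemma E_crit_coord:
  assumes "v \<in> E_crit a b"
  shows "(b * (v $ 1 + v $ 2) - a * (v $ 1 - v $ 2))\<^sup>2 \<le> 4 * a * b * (1 - (v $ 1)\<^sup>2)"
    and "(b * (v $ 1 + v $ 2) + a * (v $ 1 - v $ 2))\<^sup>2 \<le> 4 * a * b * (1 - (v $ 2)\<^sup>2)"
proof -
  define p q where pq: "p = v $ 1 + v $ 2" "q = v $ 1 - v $ 2"
  have v: "v $ 1 = (p + q) / 2" "v $ 2 = (p - q) / 2" by (simp_all add: pq)
  have b: "b = 1 - a" using ab by simp
  have "b * p\<^sup>2 + a * q\<^sup>2 \<le> 4 * a * b"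
    using assms a_pos b_pos by (simp add: E_crit_def pq field_simps)
  moreover have "b * p\<^sup>2 + a * q\<^sup>2 - (b * p - a * q)\<^sup>2 = 4 * a * b * (v $ 1)\<^sup>2"
    "b * p\<^sup>2 + a * q\<^sup>2 - (b * p + a * q)\<^sup>2 = 4 * a * b * (v $ 2)\<^sup>2"
    unfolding v b by (simp_all add: power2_eq_square algebra_simps)
  ultimately show "(b * (v $ 1 + v $ 2) - a * (v $ 1 - v $ 2))\<^sup>2 \<le> 4 * a * b * (1 - (v $ 1)\<^sup>2)"
    "(b * (v $ 1 + v $ 2) + a * (v $ 1 - v $ 2))\<^sup>2 \<le> 4 * a * b * (1 - (v $ 2)\<^sup>2)"
    unfolding pq[symmetric] right_diff_distrib by linarith+
qed

lemma E_crit_abs_le: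
  assumes "v \<in> E_crit a b"
  shows "(v $ 1)\<^sup>2 \<le> 1" "(v $ 2)\<^sup>2 \<le> 1"
proof -
  have "0 \<le> 4 * a * b * (1 - (v $ 1)\<^sup>2)" "0 \<le> 4 * a * b * (1 - (v $ 2)\<^sup>2)"
    using E_crit_coord[OF assms] by (meson order_trans zero_le_power2)+
  then show "(v $ 1)\<^sup>2 \<le> 1" "(v $ 2)\<^sup>2 \<le> 1"
    using mult_pos_pos[OF a_pos b_pos] by (simp_all add: zero_le_mult_iff)
qed

lemma E_crit_corner:
  assumes v: "v \<in> E_crit a b" and "(1 - (v $ 1)\<^sup>2) * (1 - (v $ 2)\<^sup>2) = 0"
  shows "v \<in> corners"
proof -
  have b: "b = 1 - a" using ab by simp
  consider "(v $ 1)\<^sup>2 = 1" | "(v $ 2)\<^sup>2 = 1" using assms(2) by auto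
  then show ?thesis
  proof cases
    case 1
    then have "b * (v $ 1 + v $ 2) - a * (v $ 1 - v $ 2) = 0"
      using E_crit_coord(1)[OF v] by simp
    then have "v $ 2 = v $ 1 * (a - b)" unfolding b by (simp add: algebra_simps)
    moreover have "v $ 1 = 1 \<or> v $ 1 = - 1"
      using 1 by (simp add: power2_eq_1_iff)
    ultimately have "v = vector [1, a - b] \<or> v = - vector [1, a - b]"
      unfolding vec_eq_iff forall_2 vector_2 vector_uminus_component by fastforce
    then show ?thesis by (auto simp: corners_def)
  next
    case 2
    then have "b * (v $ 1 + v $ 2) + a * (v $ 1 - v $ 2) = 0"
      using E_crit_coord(2)[OF v] by simp
    then have "v $ 1 = v $ 2 * (a - b)" unfolding b by (simp add: algebra_simps)
    moreover have "v $ 2 = 1 \<or> v $ 2 = - 1"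
      using 2 by (simp add: power2_eq_1_iff)
    ultimately have "v = vector [a - b, 1] \<or> v = - vector [a - b, 1]"
      unfolding vec_eq_iff forall_2 vector_2 vector_uminus_component by fastforce
    then show ?thesis by (auto simp: corners_def)
  qed
qed

text \<open>Both cosines vanish, so \<open>tau = 0\<close> makes the point regular and
  \<open>D = 0\<close> makes it singular. The sign of the remaining sine selects the corner.\<close>

lemma velocity_at_corner:
  assumes "k $ 2 + k $ 1 = pi / 2" "\<bar>k $ 2 - k $ 1\<bar> = pi / 2"
  shows "k \<in> Sing a b"
    and "velocity a b k = vector [- (a + b * sin (k $ 2 - k $ 1)), - (a - b * sin (k $ 2 - k $ 1))]"
proof -
  have "cos (k $ 2 + k $ 1) = 0" "sin (k $ 2 + k $ 1) = 1"
    by (simp_all only: assms(1) cos_pi_half sin_pi_half)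
  moreover have "cos (k $ 2 - k $ 1) = 0"
    by (metis assms(2) cos_abs_real cos_pi_half)
  ultimately show "k \<in> Sing a b"
    "velocity a b k = vector [- (a + b * sin (k $ 2 - k $ 1)), - (a - b * sin (k $ 2 - k $ 1))]"
    using Sing_eq[OF a_pos b_pos tau] by (auto simp: velocity_def tau_def regular_def jac_form_def)
qed

lemma velocity_Sing: "velocity a b ` Sing a b = corners"
proof
  show "velocity a b ` Sing a b \<subseteq> corners"
    using velocity_in_E_crit compl_prod by (auto simp: Sing_def intro!: E_crit_corner)
  have "- k \<in> Sing a b" if "k \<in> Sing a b" for k
  proof -
    have "jac_form a b (- k) = jac_form a b k"
      using cos_minus[of "k $ 2 + k $ 1"] cos_minus[of "k $ 2 - k $ 1"]
      by (simp add: jac_form_def add.commute)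
    then show ?thesis
      using that Sing_eq[OF a_pos b_pos tau] by (simp add: regular_uminus)
  qed
  then have sym: "- v \<in> velocity a b ` Sing a b" if "v \<in> velocity a b ` Sing a b" for v
    using that by (auto simp flip: velocity_uminus)
  \<comment> \<open>Here \<open>k $ 2 - k $ 1\<close> is \<open>pi / 2\<close> for \<open>k\<close>
    and \<open>- pi / 2\<close> for \<open>k'\<close>. These give two corners, and oddness gives
    their negatives.\<close>
  define k k' :: "real ^ 2" where "k = vector [0, pi / 2]" and "k' = vector [pi / 2, 0]"
  have "k $ 2 + k $ 1 = pi / 2" "\<bar>k $ 2 - k $ 1\<bar> = pi / 2"
    "k' $ 2 + k' $ 1 = pi / 2" "\<bar>k' $ 2 - k' $ 1\<bar> = pi / 2"
    by (simp_all add: k_def k'_def)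
  note at = velocity_at_corner[OF this(1,2)] velocity_at_corner[OF this(3,4)]
  have "velocity a b k = - vector [1, a - b]" "velocity a b k' = - vector [a - b, 1]"
    unfolding at(2,4) using ab by (simp_all add: k_def k'_def vec_eq_iff forall_2)
  then have corner: "- vector [1, a - b] \<in> velocity a b ` Sing a b"
      "- vector [a - b, 1] \<in> velocity a b ` Sing a b"
    using at(1,3) by (metis imageI)+
  show "corners \<subseteq> velocity a b ` Sing a b"
    unfolding corners_def insert_subset
    using corner sym[OF corner(1)] sym[OF corner(2)] by (simp only: minus_minus) simp
qed

lemma card_corners: "card corners = 4"
proof -
  \<comment> \<open>The strict bounds keep the four points distinct.\<close>
  have "a - b < 1" "- 1 < a - b" using a_pos b_pos ab by auto
  then show ?thesis
    by (simp add: corners_def card_insert_if vec_eq_iff forall_2)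
qed

text \<open>The velocity is undefined where \<open>\<tau>\<^sup>2 = 1\<close>, so the compactness
  argument for the image does not apply; closedness of the ellipse controls the limit
  points.\<close>

lemma Sigma_v_subset: "Sigma_v a b \<subseteq> E_crit a b"
proof -
  have "continuous_on UNIV (\<lambda>v. (v $ 1 + v $ 2)\<^sup>2 / (4 * a) + (v $ 1 - v $ 2)\<^sup>2 / (4 * b) :: real)"
    using a_pos b_pos by (intro continuous_intros) auto
  then have "closed (E_crit a b)"
    unfolding E_crit_def by (intro closed_Collect_le continuous_on_const)
  then show ?thesis
    unfolding Sigma_v_eq using velocity_in_E_crit by (intro closure_minimal) auto
qed

text \<open>At \<open>J = 0\<close> both sides take the value 0 of division by zero.\<close>

lemma f_crit_velocity:
  assumes "k \<in> regular a b"
  shows "1 / \<bar>J a b k\<bar> = pi\<^sup>2 * f_crit a b (velocity a b k)"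
  using velocity_in_E_crit[OF assms] compl_prod[OF assms] by (simp add: f_crit_def mult.assoc)

lemma diverges_on_f_crit: "diverges_on corners (Sigma_v a b) (\<lambda>v. 1) (f_crit a b)"
  unfolding diverges_on_def
proof (intro ballI allI impI)
  fix v0 S assume v0: "v0 \<in> corners" and S: "S \<subseteq> Sigma_v a b - corners"
  let ?d = "\<lambda>v::real^2. pi\<^sup>2 * (1 - (v $ 1)\<^sup>2) * (1 - (v $ 2)\<^sup>2)"
  have "continuous_on UNIV ?d"
    by (intro continuous_intros)
  moreover have "?d v0 = 0"
    using v0 by (auto simp: corners_def)
  ultimately have lim: "(?d \<longlongrightarrow> 0) (at v0 within S)"
    using tendsto_at_within_continuous_on_UNIV[of ?d v0 S] by (simp only:)
  have in_S: "eventually (\<lambda>v. v \<in> S) (at v0 within S)"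
    by (simp add: eventually_at_filter)
  have in_E: "v \<in> E_crit a b" if "v \<in> S" for v
    using S that Sigma_v_subset by auto
  have "0 < ?d v" if "v \<in> S" for v
  proof -
    \<comment> \<open>The ellipse lies in the square and meets its sides only at the corners, so the
      denominator is positive on \<open>S\<close>.\<close>
    have "(1 - (v $ 1)\<^sup>2) * (1 - (v $ 2)\<^sup>2) \<noteq> 0"
      using E_crit_corner[OF in_E[OF that]] S that by blast
    then have "0 < (1 - (v $ 1)\<^sup>2) * (1 - (v $ 2)\<^sup>2)"
      using E_crit_abs_le[OF in_E[OF that]] by (simp add: less_le)
    then show ?thesis by (simp add: mult.assoc)
  qed
  then have "eventually (\<lambda>v. 0 < ?d v) (at v0 within S)"
    by (rule eventually_mono[OF in_S])
  with lim have "filterlim (\<lambda>v. 1 / ?d v) at_top (at v0 within S)"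
    by (intro LIM_at_top_divide[of _ 1]) auto
  then show "filterlim (f_crit a b) at_top (at v0 within S)"
    by (rule iffD1[OF filterlim_cong[OF refl refl], rotated])
      (rule eventually_mono[OF in_S], simp add: f_crit_def in_E)
qed

lemma diverges_on_limit:
  assumes "\<And>v. 0 \<le> w v"
  shows "diverges_on corners (Sigma_v a b) w (\<lambda>v. w v * f_crit a b v)"
  \<comment> \<open>The sum of two densities is used with one weight equal to 0.\<close>
  using diverges_on_weighted[OF diverges_on_f_crit diverges_on_f_crit assms, of "\<lambda>_. 0"] by simp

end

theorem theorem18:
  fixes a1 a2 a b :: real
  assumes "a1 \<in> {0..1}" and "a2 \<in> {0..1}"
    and "a = par_a a1 a2" and "b = par_b a1 a2"
    and "a > 0" and "b > 0"
  shows
    "(a + b < 1 \<longrightarrow>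
        (\<forall>k. J a b k < 0 \<longrightarrow> 1 / \<bar>J a b k\<bar> = pi\<^sup>2 * f_plus a1 a2 (velocity a b k)) \<and>
        (\<forall>k. J a b k > 0 \<longrightarrow> 1 / \<bar>J a b k\<bar> = pi\<^sup>2 * f_minus a1 a2 (velocity a b k)) \<and>
        velocity a b ` Sing a b = frontier (Sigma_v a b) \<and>
        diverges_on (velocity a b ` Sing a b) (Sigma_v a b) (\<lambda>v. 1) (f_plus a1 a2) \<and>
        diverges_on (velocity a b ` Sing a b) (Sigma_v a b) (\<lambda>v. 1) (f_minus a1 a2) \<and>
        (\<forall>\<Psi> w_plus w_minus.
           normalized \<Psi> \<and> (\<forall>v. 0 \<le> w_plus v) \<and> (\<forall>v. 0 \<le> w_minus v) \<and>
           limit_pdf a1 a2 \<Psi> (\<lambda>v. w_plus v * f_plus a1 a2 v + w_minus v * f_minus a1 a2 v) \<longrightarrow>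
           diverges_on (velocity a b ` Sing a b) (Sigma_v a b) (\<lambda>v. w_plus v + w_minus v)
             (\<lambda>v. w_plus v * f_plus a1 a2 v + w_minus v * f_minus a1 a2 v))) \<and>
     (a + b = 1 \<longrightarrow>
        (\<forall>k \<in> regular a b. J a b k \<noteq> 0 \<longrightarrow>
           1 / \<bar>J a b k\<bar> = pi\<^sup>2 * f_crit a b (velocity a b k)) \<and>
        velocity a b ` Sing a b =
          {vector [1, a - b], - vector [1, a - b], vector [a - b, 1], - vector [a - b, 1]} \<and>
        card (velocity a b ` Sing a b) = 4 \<and>
        diverges_on (velocity a b ` Sing a b) (Sigma_v a b) (\<lambda>v. 1) (f_crit a b) \<and>
        (\<forall>\<Psi> w_plus.
           normalized \<Psi> \<and> (\<forall>v. 0 \<le> w_plus v) \<and>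
           limit_pdf a1 a2 \<Psi> (\<lambda>v. w_plus v * f_crit a b v) \<longrightarrow>
           diverges_on (velocity a b ` Sing a b) (Sigma_v a b) w_plus
             (\<lambda>v. w_plus v * f_crit a b v)))"
proof ((rule conjI; rule impI), goal_cases)
  case 1
  then interpret subcritical a1 a2 a b
    using assms by unfold_locales
  show ?case
    using f_plus_velocity f_minus_velocity frontier_Sigma_v diverges_on_f_plus diverges_on_f_minus
      diverges_on_limit by simp
next
  case 2
  then interpret critical a b
    using assms by unfold_locales
  show ?case
    by (intro conjI allI impI ballI)
      (simp_all add: f_crit_velocity velocity_Sing card_corners diverges_on_f_crit diverges_on_limit
        flip: corners_def)
qed

end
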